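(* Let $B,A_1,\dots,A_p$ be random variables on a common probability space with values in $\{-1,1\}$, let $\bm{A}=(A_1,\dots,A_p)^\top$, and suppose that $\mathbf{E}[\bm{A}^{\otimes}\bm{A}^{\otimes\top}]$ is positive definite. Let $\bm{\beta}\in\mathbb{R}^{2^p}$ be such that $\mathbf{E}[B\mid\bm{A}]=\bm{\beta}^\top\bm{A}^{\otimes}$, and write $\beta_\Lambda$ for the coefficient in $\bm{\beta}$ of the element $\Lambda\in G_{\bm{A}}$. 1. Let $\mathcal{L}=\{\Lambda\in G_{\bm{A}}:\beta_\Lambda\ne 0\}$ and let $G_{\mathcal{L}}=\langle\mathcal{L}\rangle$. Then $B$ is conditionally independent of $G_{\bm{A}}$ given $G_{\mathcal{L}}$. 2. Let $S\subseteq G_{\bm{A}}$. If $B$ is conditionally independent of $G_{\bm{A}}$ given $S$, then $\beta_\Lambda=0$ for every $\Lambda\in G_{\bm{A}}\setminus\langle S\rangle$.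
   Context: For $\bm{A}\in\{-1,1\}^p$, $\bm{A}^{\otimes}=\begin{pmatrix}1\\ A_1\end{pmatrix}\otimes\cdots\otimes\begin{pmatrix}1\\ A_p\end{pmatrix}$ is the $2^p$-vector whose coordinates are all products $\prod_{j\in\Lambda}A_j$, $\Lambda\subseteq\{1,\dots,p\}$. Positive definiteness of $\mathbf{E}[\bm{A}^{\otimes}\bm{A}^{\otimes\top}]$ is equivalent to $\bm{A}$ taking all $2^p$ values with positive probability, and it makes the $2^p$ coordinates of $\bm{A}^{\otimes}$ distinct random variables and $\bm{\beta}$ unique. For a set $S$ of $\{-1,1\}$-valued random variables, $\langle S\rangle$ is the group generated by $S$ under pointwise multiplication (with $\langle\emptyset\rangle=\{1\}$). $G_{\bm{A}}=\langle\{A_1,\dots,A_p\}\rangle$; its elements are exactly the coordinates of $\bm{A}^{\otimes}$. (Conditional) independence with respect to a set of random variables means with respect to the $\sigma$-field it generates. *)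

theory Defs
  imports
    "HOL-Probability.Probability"
    "HOL-Algebra.Generated_Groups"
    "Jordan_Normal_Form.Matrix"
begin

no_notation inner (infix "\<bullet>" 70)
no_notation vec_nth (infixl "$" 90)

definition kron_vec :: "'b::times Matrix.vec \<Rightarrow> 'b Matrix.vec \<Rightarrow> 'b Matrix.vec" where
  "kron_vec u v = Matrix.vec (dim_vec u * dim_vec v)
     (\<lambda>i. u $ (i div dim_vec v) * v $ (i mod dim_vec v))"

text \<open>The Kronecker product \<open>(1, x 1) \<otimes> \<dots> \<otimes> (1, x p)\<close>, of dimension \<open>2 ^ p\<close>; the empty
  product is the unit \<open>(1)\<close> of the Kronecker product.\<close>

primrec tensor_vec :: "(nat \<Rightarrow> 'b::comm_ring_1) \<Rightarrow> nat \<Rightarrow> 'b Matrix.vec" where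
  "tensor_vec x 0 = vec_of_list [1]"
| "tensor_vec x (Suc p) = kron_vec (tensor_vec x p) (vec_of_list [1, x (Suc p)])"

definition outer_prod :: "'b::times Matrix.vec \<Rightarrow> 'b Matrix.vec \<Rightarrow> 'b Matrix.mat" where
  "outer_prod u v = Matrix.mat (dim_vec u) (dim_vec v) (\<lambda>(i, j). u $ i * v $ j)"

definition expectation_mat ::
    "'a measure \<Rightarrow> nat \<Rightarrow> nat \<Rightarrow> ('a \<Rightarrow> real Matrix.mat) \<Rightarrow> real Matrix.mat" where
  "expectation_mat M m n X = Matrix.mat m n (\<lambda>(i, j). \<integral>\<omega>. X \<omega> $$ (i, j) \<partial>M)"

definition positive_definite :: "nat \<Rightarrow> real Matrix.mat \<Rightarrow> bool" where
  "positive_definite n Q \<longleftrightarrow> Q \<in> carrier_mat n n \<and> transpose_mat Q = Q \<and>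
     (\<forall>v \<in> carrier_vec n. v \<noteq> 0\<^sub>v n \<longrightarrow> v \<bullet> (Q *\<^sub>v v) > 0)"

definition rv_sigma :: "'a measure \<Rightarrow> ('a \<Rightarrow> real) set \<Rightarrow> 'a measure" where
  "rv_sigma M S = sigma (space M) (\<Union>X\<in>S. {X -` T \<inter> space M | T. T \<in> sets borel})"

text \<open>Conditional independence of the \<open>\<sigma>\<close>-fields \<open>F\<close> and \<open>G\<close> given the \<open>\<sigma>\<close>-field \<open>H\<close>,
  all meant to be sub-\<open>\<sigma>\<close>-fields of \<open>M\<close>.\<close>

definition cond_indep_sigma ::
    "'a measure \<Rightarrow> 'a measure \<Rightarrow> 'a measure \<Rightarrow> 'a measure \<Rightarrow> bool" where
  "cond_indep_sigma M F G H \<longleftrightarrow>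
     (\<forall>a \<in> sets F. \<forall>b \<in> sets G. AE \<omega> in M.
        real_cond_exp M H (indicator (a \<inter> b)) \<omega> =
        real_cond_exp M H (indicator a) \<omega> * real_cond_exp M H (indicator b) \<omega>)"

definition cond_indep_rvs ::
    "'a measure \<Rightarrow> ('a \<Rightarrow> real) set \<Rightarrow> ('a \<Rightarrow> real) set \<Rightarrow> ('a \<Rightarrow> real) set \<Rightarrow> bool" where
  "cond_indep_rvs M X Y Z \<longleftrightarrow>
     cond_indep_sigma M (rv_sigma M X) (rv_sigma M Y) (rv_sigma M Z)"

text \<open>The group of all \<open>{-1, 1}\<close>-valued random variables under pointwise multiplication. Random
  variables are functions on \<open>space M\<close>, hence represented as extensional functions, so that
  values outside \<open>space M\<close> play no role in the equality of group elements.\<close>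

definition sign_rv_group :: "'a measure \<Rightarrow> ('a \<Rightarrow> real) monoid" where
  "sign_rv_group M =
     \<lparr> carrier = {X \<in> borel_measurable M. X \<in> space M \<rightarrow>\<^sub>E {-1, 1}},
       monoid.mult = (\<lambda>X Y. \<lambda>\<omega>\<in>space M. X \<omega> * Y \<omega>),
       one = (\<lambda>\<omega>\<in>space M. 1) \<rparr>"

lemma comm_group_sign_rv_group: "comm_group (sign_rv_group M)"
proof (rule comm_groupI, goal_cases)
  case (1 X Y)
  then have "(\<lambda>\<omega>. X \<omega> * Y \<omega>) \<in> borel_measurable M"
    by (auto simp: sign_rv_group_def)
  then have "(\<lambda>\<omega>\<in>space M. X \<omega> * Y \<omega>) \<in> borel_measurable M"
    by (subst measurable_cong[where g = "\<lambda>\<omega>. X \<omega> * Y \<omega>"]) auto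
  moreover have "X \<omega> * Y \<omega> \<in> {-1, 1}" if "\<omega> \<in> space M" for \<omega>
  proof -
    have "X \<omega> \<in> {-1, 1}" "Y \<omega> \<in> {-1, 1}"
      using 1 that unfolding sign_rv_group_def by (simp_all only: partial_object.simps PiE_iff mem_Collect_eq)
    then show ?thesis by auto
  qed
  ultimately show ?case by (auto simp: sign_rv_group_def)
next
  case 2
  have "(\<lambda>\<omega>\<in>space M. 1 :: real) \<in> borel_measurable M"
    by (subst measurable_cong[where g = "\<lambda>\<omega>. 1"]) auto
  then show ?case by (auto simp: sign_rv_group_def)
next
  case (3 X Y Z)
  then show ?case by (auto simp: sign_rv_group_def fun_eq_iff restrict_def)
next
  case (4 X Y)
  then show ?case by (auto simp: sign_rv_group_def fun_eq_iff restrict_def)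
next
  case (5 X)
  then have "X \<in> extensional (space M)" by (auto simp: sign_rv_group_def PiE_def)
  then show ?case by (auto simp: sign_rv_group_def fun_eq_iff restrict_def extensional_def)
next
  case (6 X)
  have "X \<omega> * X \<omega> = 1" if "\<omega> \<in> space M" for \<omega>
  proof -
    have "X \<omega> \<in> {-1, 1}"
      using 6 that unfolding sign_rv_group_def by (simp only: partial_object.simps PiE_iff mem_Collect_eq)
    then show ?thesis by auto
  qed
  then have "X \<otimes>\<^bsub>sign_rv_group M\<^esub> X = \<one>\<^bsub>sign_rv_group M\<^esub>"
    by (auto simp: sign_rv_group_def fun_eq_iff restrict_def)
  with 6 show ?case by blast
qed

definition rv_group :: "'a measure \<Rightarrow> (nat \<Rightarrow> 'a \<Rightarrow> real) \<Rightarrow> nat \<Rightarrow> ('a \<Rightarrow> real) set" where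
  "rv_group M A p = generate (sign_rv_group M) ((\<lambda>j. restrict (A j) (space M)) ` {1..p})"

text \<open>The coefficient in \<open>\<beta>\<close> of a group element \<open>\<Lambda>\<close>: the entry of \<open>\<beta>\<close> at the position at which
  \<open>\<Lambda>\<close> occurs as a coordinate of the tensor vector. The position is unique when the coordinates
  are distinct random variables.\<close>

definition coeff_of ::
    "'a measure \<Rightarrow> (nat \<Rightarrow> 'a \<Rightarrow> real) \<Rightarrow> nat \<Rightarrow> real Matrix.vec \<Rightarrow> ('a \<Rightarrow> real) \<Rightarrow> real" where
  "coeff_of M A p \<beta> \<Lambda> =
     \<beta> $ (THE k. k < 2 ^ p \<and> (\<lambda>\<omega>\<in>space M. tensor_vec (\<lambda>j. A j \<omega>) p $ k) = \<Lambda>)"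

end

theory Submission
  imports Defs
begin

text \<open>Since \<open>B\<close> takes two values, indicators of events in its \<open>\<sigma>\<close>-field are affine functions of
  \<open>B\<close>, so conditional independence of \<open>B\<close> and \<open>G\<^sub>A\<close> given \<open>S \<subseteq> G\<^sub>A\<close> amounts to
  \<open>E[B | A] = E[B | S]\<close> almost everywhere. For part 1, \<open>\<beta> \<bullet> tensor_vec A\<close> only involves elements of
  \<open>\<L>\<close>, hence is measurable with respect to the \<open>\<sigma>\<close>-field of the group they generate. For part 2,
  every function that is measurable with respect to \<open>S\<close> is a linear combination of elements of
  \<open>\<langle>S\<rangle>\<close>; positive definiteness makes the coordinates of the tensor vector linearly independent
  modulo null sets, so comparing coefficients in \<open>E[B | S] = \<beta> \<bullet> tensor_vec A\<close> yields the claim.\<close>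

section \<open>Conditional independence as equality of conditional expectations\<close>

text \<open>From right to left: the indicator of \<open>b\<close> is pulled out of the conditioning
  on \<open>F\<close>, the remaining factor is already \<open>H\<close>-measurable, and conditioning
  on \<open>H\<close> with the tower property gives the product formula. From left to right:
  integrating the product formula shows that the conditional probability of \<open>a\<close> given
  \<open>H\<close> has the same integral over each \<open>b\<close> in \<open>F\<close> as the
  indicator of \<open>a\<close>, which characterises conditioning on \<open>F\<close>.\<close>

lemma real_cond_exp_indep_event_iff:
  assumes M: "prob_space M" and F: "subalgebra M F" and H: "subalgebra F H"
    and a: "a \<in> sets M"
  shows "(\<forall>b\<in>sets F. AE \<omega> in M. real_cond_exp M H (indicator (a \<inter> b)) \<omega> =
            real_cond_exp M H (indicator a) \<omega> * real_cond_exp M H (indicator b) \<omega>) \<longleftrightarrow>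
         (AE \<omega> in M. real_cond_exp M F (indicator a) \<omega> = real_cond_exp M H (indicator a) \<omega>)"
    (is "?L \<longleftrightarrow> ?R")
proof -
  interpret M: prob_space M by fact
  have MH: "subalgebra M H"
    using F H by (auto simp: subalgebra_def)
  interpret F: finite_measure_subalgebra M F by unfold_locales fact
  interpret H: finite_measure_subalgebra M H by unfold_locales fact
  have int: "integrable M (indicator c :: _ \<Rightarrow> real)" if "c \<in> sets M" for c
    using that by (simp add: M.emeasure_eq_measure)
  have FM: "b \<in> sets M" if "b \<in> sets F" for b
    using that F by (auto simp: subalgebra_def)
  have Ha: "real_cond_exp M H (indicator a) \<in> borel_measurable F"
    using measurable_from_subalg[OF H borel_measurable_cond_exp] .
  \<comment> \<open>The factor of \<open>b\<close> comes first because
    \<open>real_cond_exp_mult\<close> pulls out the left factor.\<close>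
  have ind: "indicator (a \<inter> b) = (\<lambda>x. indicator b x * indicator a x :: real)" for b :: "'a set"
    by (auto simp: fun_eq_iff indicator_def)
  show ?thesis
  proof
    assume R: ?R
    show ?L
    proof
      fix b assume b: "b \<in> sets F"
      note bM = FM[OF b]
      note [measurable] = a bM b
      have 1: "AE \<omega> in M. real_cond_exp M F (indicator (a \<inter> b)) \<omega> =
          indicator b \<omega> * real_cond_exp M F (indicator a) \<omega>"
        unfolding ind
        by (rule F.real_cond_exp_mult) (use int[of "a \<inter> b"] a bM in \<open>auto simp: ind[symmetric]\<close>)
      have 2: "AE \<omega> in M. real_cond_exp M F (indicator (a \<inter> b)) \<omega> =
          real_cond_exp M H (indicator a) \<omega> * indicator b \<omega>"
        using 1 R by eventually_elim simp
      have 3: "AE \<omega> in M. real_cond_exp M H (real_cond_exp M F (indicator (a \<inter> b))) \<omega> =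
          real_cond_exp M H (\<lambda>\<omega>. real_cond_exp M H (indicator a) \<omega> * indicator b \<omega>) \<omega>"
        by (rule H.real_cond_exp_cong[OF 2]) measurable
      have 4: "AE \<omega> in M. real_cond_exp M H (real_cond_exp M F (indicator (a \<inter> b))) \<omega> =
          real_cond_exp M H (indicator (a \<inter> b)) \<omega>"
        by (rule H.real_cond_exp_nested_subalg[OF F H]) (use int a bM in auto)
      have 5: "AE \<omega> in M. real_cond_exp M H (\<lambda>\<omega>. real_cond_exp M H (indicator a) \<omega> * indicator b \<omega>) \<omega> =
          real_cond_exp M H (indicator a) \<omega> * real_cond_exp M H (indicator b) \<omega>"
        by (rule H.real_cond_exp_mult)
          (auto intro!: integrable_real_mult_indicator H.real_cond_exp_int int a bM)
      show "AE \<omega> in M. real_cond_exp M H (indicator (a \<inter> b)) \<omega> =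
            real_cond_exp M H (indicator a) \<omega> * real_cond_exp M H (indicator b) \<omega>"
        using 3 4 5 by eventually_elim simp
    qed
  next
    assume L: ?L
    show ?R
    proof (rule F.real_cond_exp_charact)
      fix b assume b: "b \<in> sets F"
      note bM = FM[OF b]
      note [measurable] = a bM b
      have "(\<integral>x\<in>b. indicator a x \<partial>M) = (\<integral>x. indicator (a \<inter> b) x \<partial>M :: real)"
        by (simp add: set_lebesgue_integral_def ind)
      also have "\<dots> = (\<integral>x. real_cond_exp M H (indicator (a \<inter> b)) x \<partial>M)"
        by (rule H.real_cond_exp_int(2)[symmetric]) (use int a bM in auto)
      also have "\<dots> = (\<integral>x. real_cond_exp M H (indicator a) x * real_cond_exp M H (indicator b) x \<partial>M)"
        by (rule integral_cong_AE) (use L b in auto)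
      \<comment> \<open>Against an \<open>H\<close>-measurable factor, a function and its
        conditional expectation given \<open>H\<close> have the same integral.\<close>
      also have "\<dots> = (\<integral>x. real_cond_exp M H (indicator a) x * indicator b x \<partial>M)"
        by (rule H.real_cond_exp_intg(2))
          (auto intro!: integrable_real_mult_indicator H.real_cond_exp_int int a bM)
      also have "\<dots> = (\<integral>x\<in>b. real_cond_exp M H (indicator a) x \<partial>M)"
        by (simp add: set_lebesgue_integral_def mult.commute)
      finally show "(\<integral>x\<in>b. indicator a x \<partial>M) = (\<integral>x\<in>b. real_cond_exp M H (indicator a) x \<partial>M)" .
    qed (auto intro!: H.real_cond_exp_int int a Ha)
  qed
qed

section \<open>Sigma-fields generated by random variables\<close>

lemma space_rv_sigma [simp]: "space (rv_sigma M S) = space M"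
  by (simp add: rv_sigma_def space_measure_of_conv)

lemma sets_rv_sigma:
  "sets (rv_sigma M S) = sigma_sets (space M) (\<Union>X\<in>S. {X -` T \<inter> space M | T. T \<in> sets borel})"
  unfolding rv_sigma_def by (rule sets_measure_of) auto

lemma measurable_rv_sigma: "X \<in> S \<Longrightarrow> X \<in> borel_measurable (rv_sigma M S)"
  by (rule measurableI) (auto simp: sets_rv_sigma)

lemma sets_rv_sigma_subset:
  assumes "space N = space M" and "\<And>X. X \<in> S \<Longrightarrow> X \<in> borel_measurable N"
  shows "sets (rv_sigma M S) \<subseteq> sets N"
proof -
  have "(\<Union>X\<in>S. {X -` T \<inter> space M | T. T \<in> sets borel}) \<subseteq> sets N"
    using assms by (auto simp flip: assms(1))
  then show ?thesis
    using sets.sigma_sets_subset[of _ N] assms(1) by (simp add: sets_rv_sigma)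
qed

text \<open>The sets that do not separate the two points include all generators and are closed under
  complements and countable unions.\<close>

lemma rv_sigma_saturated:
  assumes "b \<in> sets (rv_sigma M S)" "\<omega> \<in> space M" "\<omega>' \<in> space M"
    and "\<And>X. X \<in> S \<Longrightarrow> X \<omega> = X \<omega>'"
  shows "\<omega> \<in> b \<longleftrightarrow> \<omega>' \<in> b"
  using assms(1) unfolding sets_rv_sigma
proof (induction rule: sigma_sets.induct)
  case (Basic a)
  then obtain X T where "X \<in> S" "a = X -` T \<inter> space M" by auto
  then show ?case using assms(2,3) assms(4)[of X] by simp
qed (use assms(2,3) in auto)

text \<open>Saturation is applied to the fibre of \<open>f\<close> through \<omega>. This takes the
  place of a factorisation of \<open>f\<close> through the members of \<open>S\<close>.\<close>

lemma borel_measurable_rv_sigma_saturated: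
  fixes f :: "'a \<Rightarrow> real"
  assumes f: "f \<in> borel_measurable (rv_sigma M S)" and \<omega>: "\<omega> \<in> space M" "\<omega>' \<in> space M"
    and "\<And>X. X \<in> S \<Longrightarrow> X \<omega> = X \<omega>'"
  shows "f \<omega> = f \<omega>'"
proof -
  have "f -` {f \<omega>} \<inter> space M \<in> sets (rv_sigma M S)"
    using measurable_sets[OF f, of "{f \<omega>}"] by simp
  from rv_sigma_saturated[OF this assms(2-)] \<omega> show ?thesis by auto
qed

text \<open>The event \<open>B = 1\<close> alone recovers \<open>B\<close>, and \<open>B\<close>
  recovers every event it generates, each time by an affine map. Conditional expectation commutes
  with such maps, so the equality of the two conditional expectations passes between
  \<open>B\<close> and its events.\<close>

lemma cond_indep_sigma_sign_iff:
  assumes M: "prob_space M" and F: "subalgebra M F" and H: "subalgebra F H"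
    and B: "B \<in> borel_measurable M" "\<And>\<omega>. \<omega> \<in> space M \<Longrightarrow> B \<omega> \<in> {-1, 1}"
  shows "cond_indep_sigma M (rv_sigma M {B}) F H \<longleftrightarrow>
     (AE \<omega> in M. real_cond_exp M F B \<omega> = real_cond_exp M H B \<omega>)"
proof -
  interpret M: prob_space M by fact
  have MH: "subalgebra M H"
    using F H by (auto simp: subalgebra_def)
  interpret F: finite_measure_subalgebra M F by unfold_locales fact
  interpret H: finite_measure_subalgebra M H by unfold_locales fact
  have sub: "sets (rv_sigma M {B}) \<subseteq> sets M"
    by (rule sets_rv_sigma_subset) (use B in auto)
  have intB: "integrable M B"
    by (rule M.integrable_const_bound[of _ 1]) (use B in \<open>auto intro!: AE_I2 dest!: B(2)\<close>)
  have affine: "AE \<omega> in M. real_cond_exp M K g \<omega> = c + d * real_cond_exp M K f \<omega>"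
    if K: "finite_measure_subalgebra M K" and f: "integrable M f" "g \<in> borel_measurable M"
      and g: "\<And>\<omega>. \<omega> \<in> space M \<Longrightarrow> g \<omega> = c + d * f \<omega>" for K f g and c d :: real
  proof -
    interpret K: finite_measure_subalgebra M K by fact
    note [measurable] = f(2) borel_measurable_integrable[OF f(1)]
    have "AE \<omega> in M. real_cond_exp M K g \<omega> = real_cond_exp M K (\<lambda>\<omega>. c + d * f \<omega>) \<omega>"
      by (rule K.real_cond_exp_cong) (use g in auto)
    moreover have "AE \<omega> in M. real_cond_exp M K (\<lambda>\<omega>. c + d * f \<omega>) \<omega> =
        real_cond_exp M K (\<lambda>\<omega>. c) \<omega> + real_cond_exp M K (\<lambda>\<omega>. d * f \<omega>) \<omega>"
      by (rule K.real_cond_exp_add) (use f in auto)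
    moreover have "AE \<omega> in M. real_cond_exp M K (\<lambda>\<omega>. c) \<omega> = c"
      by (rule K.real_cond_exp_F_meas) auto
    moreover have "AE \<omega> in M. real_cond_exp M K (\<lambda>\<omega>. d * f \<omega>) \<omega> = d * real_cond_exp M K f \<omega>"
      using f by auto
    ultimately show ?thesis by eventually_elim simp
  qed
  have subalg: "finite_measure_subalgebra M F" "finite_measure_subalgebra M H" by unfold_locales
  show ?thesis (is "?L \<longleftrightarrow> ?R")
  proof
    assume L: ?L
    define a where "a = B -` {1} \<inter> space M"
    have a: "a \<in> sets (rv_sigma M {B})"
      using measurable_sets[OF measurable_rv_sigma[of B "{B}" M], of "{1}"] by (simp add: a_def)
    with sub have aM: "a \<in> sets M" by blast
    have eq: "AE \<omega> in M. real_cond_exp M F (indicator a) \<omega> = real_cond_exp M H (indicator a) \<omega>"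
      using L a unfolding real_cond_exp_indep_event_iff[OF M F H aM, symmetric] cond_indep_sigma_def
      by blast
    have 1: "AE \<omega> in M. real_cond_exp M K B \<omega> = -1 + 2 * real_cond_exp M K (indicator a) \<omega>"
      if "finite_measure_subalgebra M K" for K
      by (rule affine[OF that]) (use B aM in \<open>auto simp: a_def indicator_def M.emeasure_eq_measure\<close>)
    show ?R
      using eq 1[OF subalg(1)] 1[OF subalg(2)] by eventually_elim simp
  next
    assume R: ?R
    show ?L unfolding cond_indep_sigma_def
    proof
      fix a assume a: "a \<in> sets (rv_sigma M {B})"
      with sub have aM: "a \<in> sets M" by blast
      \<comment> \<open>By saturation \<open>a\<close> is a union of fibres of \<open>B\<close>, so
        its indicator factors through \<open>B\<close> as \<open>h\<close>. On the two points 1 and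
        -1, \<open>h\<close> agrees with the affine function interpolating it.\<close>
      define h where "h t = (if \<exists>\<omega>\<in>a. B \<omega> = t then 1 else 0 :: real)" for t
      have h: "indicator a \<omega> = h (B \<omega>)" if "\<omega> \<in> space M" for \<omega>
      proof -
        have "\<omega> \<in> a" if "\<omega>' \<in> a" "B \<omega>' = B \<omega>" for \<omega>'
          using rv_sigma_saturated[OF a, of \<omega>' \<omega>] that \<open>\<omega> \<in> space M\<close> sets.sets_into_space[OF a]
          by auto
        then show ?thesis by (auto simp: h_def indicator_def)
      qed
      have "indicator a \<omega> = (h 1 + h (-1)) / 2 + (h 1 - h (-1)) / 2 * B \<omega>" if "\<omega> \<in> space M" for \<omega>
        using B(2)[OF that] unfolding h[OF that] by (elim insertE emptyE) (simp_all add: field_simps)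
      then have 1: "AE \<omega> in M. real_cond_exp M K (indicator a) \<omega> =
          (h 1 + h (-1)) / 2 + (h 1 - h (-1)) / 2 * real_cond_exp M K B \<omega>"
        if "finite_measure_subalgebra M K" for K
        by (intro affine[OF that intB]) (use aM in auto)
      have "AE \<omega> in M. real_cond_exp M F (indicator a) \<omega> = real_cond_exp M H (indicator a) \<omega>"
        using R 1[OF subalg(1)] 1[OF subalg(2)] by eventually_elim simp
      then show "\<forall>b\<in>sets F. AE \<omega> in M. real_cond_exp M H (indicator (a \<inter> b)) \<omega> =
            real_cond_exp M H (indicator a) \<omega> * real_cond_exp M H (indicator b) \<omega>"
        unfolding real_cond_exp_indep_event_iff[OF M F H aM] .
    qed
  qed
qed

section \<open>Functions of finitely many signs\<close>

text \<open>A function that depends only on finitely many signs is a polynomial in them; this is the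
  corresponding induction principle. Splitting off one sign \<open>s\<close> leaves two functions of
  the other signs, combined by a sum and one multiplication by \<open>s\<close>, so closure under
  multiplication by single members of \<open>S\<close> suffices.\<close>

lemma saturated_induct:
  fixes f :: "'a \<Rightarrow> real"
  assumes S: "finite S" "\<And>X \<omega>. X \<in> S \<Longrightarrow> \<omega> \<in> \<Omega> \<Longrightarrow> X \<omega> \<in> {-1, 1}"
    and cong: "\<And>f g. (\<And>\<omega>. \<omega> \<in> \<Omega> \<Longrightarrow> f \<omega> = g \<omega>) \<Longrightarrow> P g \<Longrightarrow> P f"
    and const: "\<And>c. P (\<lambda>\<omega>. c)"
    and add: "\<And>f g. P f \<Longrightarrow> P g \<Longrightarrow> P (\<lambda>\<omega>. f \<omega> + g \<omega>)"
    and mult: "\<And>X f. X \<in> S \<Longrightarrow> P f \<Longrightarrow> P (\<lambda>\<omega>. X \<omega> * f \<omega>)"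
    and sat: "\<And>\<omega> \<omega>'. \<omega> \<in> \<Omega> \<Longrightarrow> \<omega>' \<in> \<Omega> \<Longrightarrow> (\<And>X. X \<in> S \<Longrightarrow> X \<omega> = X \<omega>') \<Longrightarrow> f \<omega> = f \<omega>'"
  shows "P f"
  using S mult sat
proof (induction S arbitrary: f rule: finite_induct)
  case empty
  \<comment> \<open>With no signs left, \<open>f\<close> is constant on \<Omega> and its value is
    read off at a chosen point. For empty \<Omega> the equation is vacuous.\<close>
  have "f \<omega> = f (SOME \<omega>. \<omega> \<in> \<Omega>)" if "\<omega> \<in> \<Omega>" for \<omega>
    using that someI[of "\<lambda>\<omega>. \<omega> \<in> \<Omega>"] by (intro empty.prems) auto
  then show ?case by (rule cong) (assumption, rule const)
next
  case (insert s S)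
  \<comment> \<open>On \<open>\<Omega>\<close>, \<open>f\<close> equals \<open>g 1\<close> where \<open>s = 1\<close> and \<open>g (-1)\<close> where \<open>s = -1\<close>, and \<open>g t\<close> depends on \<open>S\<close> only.
    The value 0 for empty fibres is arbitrary.\<close>
  define R where "R t \<omega> \<omega>' \<longleftrightarrow> \<omega>' \<in> \<Omega> \<and> s \<omega>' = t \<and> (\<forall>X\<in>S. X \<omega>' = X \<omega>)" for t \<omega> \<omega>'
  define g where "g t \<omega> = (if \<exists>\<omega>'. R t \<omega> \<omega>' then f (SOME \<omega>'. R t \<omega> \<omega>') else 0)" for t \<omega>
  \<comment> \<open>\<open>R t \<omega>\<close> sees \<omega> only through the values of
    \<open>S\<close>, so the choice made in \<open>g\<close> is literally the same at both
    points.\<close>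
  have g_cong: "g t \<omega> = g t \<omega>'" if "\<And>X. X \<in> S \<Longrightarrow> X \<omega> = X \<omega>'" for t \<omega> \<omega>'
  proof -
    have "(\<forall>X\<in>S. X z = X \<omega>) \<longleftrightarrow> (\<forall>X\<in>S. X z = X \<omega>')" for z
      by (rule ball_cong) (simp_all add: that)
    then have "R t \<omega> = R t \<omega>'" by (simp add: R_def fun_eq_iff)
    then show ?thesis by (simp add: g_def)
  qed
  have g: "f \<omega> = g (s \<omega>) \<omega>" if "\<omega> \<in> \<Omega>" for \<omega>
  proof -
    have ex: "R (s \<omega>) \<omega> \<omega>" using that by (simp add: R_def)
    then have "R (s \<omega>) \<omega> (SOME \<omega>'. R (s \<omega>) \<omega> \<omega>')" by (rule someI)
    then have "f \<omega> = f (SOME \<omega>'. R (s \<omega>) \<omega> \<omega>')"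
      using that by (intro insert.prems(3)) (auto simp: R_def)
    with ex show ?thesis by (auto simp: g_def)
  qed
  have P: "P h" if "\<And>\<omega> \<omega>'. (\<And>X. X \<in> S \<Longrightarrow> X \<omega> = X \<omega>') \<Longrightarrow> h \<omega> = h \<omega>'" for h
  proof (rule insert.IH)
    show "X \<omega> \<in> {-1, 1}" if "X \<in> S" "\<omega> \<in> \<Omega>" for X \<omega>
      using that by (intro insert.prems(1)) simp_all
    show "P (\<lambda>\<omega>. X \<omega> * f \<omega>)" if "X \<in> S" "P f" for X f
      using that by (intro insert.prems(2)) simp_all
  qed (rule that)
  \<comment> \<open>Linear interpolation in \<open>s\<close>: the expression equals
    \<open>g 1\<close> where \<open>s\<close> is 1 and \<open>g (-1)\<close> where \<open>s\<close>
    is -1.\<close>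
  have "P (\<lambda>\<omega>. (g 1 \<omega> + g (-1) \<omega>) / 2 + s \<omega> * ((g 1 \<omega> - g (-1) \<omega>) / 2))"
  proof (rule add)
    show "P (\<lambda>\<omega>. (g 1 \<omega> + g (-1) \<omega>) / 2)"
      by (rule P, rule arg_cong2[where f = "\<lambda>x y. (x + y) / 2"]; erule g_cong)
    have "P (\<lambda>\<omega>. (g 1 \<omega> - g (-1) \<omega>) / 2)"
      by (rule P, rule arg_cong2[where f = "\<lambda>x y. (x - y) / 2"]; erule g_cong)
    then show "P (\<lambda>\<omega>. s \<omega> * ((g 1 \<omega> - g (-1) \<omega>) / 2))"
      by (rule insert.prems(2)[OF insertI1])
  qed
  moreover have "f \<omega> = (g 1 \<omega> + g (-1) \<omega>) / 2 + s \<omega> * ((g 1 \<omega> - g (-1) \<omega>) / 2)" if "\<omega> \<in> \<Omega>" for \<omega>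
  proof -
    have "s \<omega> = -1 \<or> s \<omega> = 1" using insert.prems(1)[of s \<omega>] that by simp
    then show ?thesis using g[OF that] by (elim disjE) (simp_all add: field_simps)
  qed
  ultimately show ?case by (rule cong[rotated])
qed

section \<open>Coordinates of the tensor vector\<close>

lemma dim_tensor_vec [simp]: "dim_vec (tensor_vec x p) = 2 ^ p"
  by (induction p) (simp_all add: kron_vec_def)

text \<open>Read in binary, the index encodes a set of variables. The newest variable occupies the
  lowest bit, and \<open>k div 2\<close> encodes the choice among the earlier ones.\<close>

lemma tensor_vec_Suc:
  assumes "k < 2 ^ Suc p"
  shows "tensor_vec x (Suc p) $ k = tensor_vec x p $ (k div 2) * (if even k then 1 else x (Suc p))"
proof -
  have "tensor_vec x (Suc p) $ k = tensor_vec x p $ (k div 2) * vec_of_list [1, x (Suc p)] $ (k mod 2)"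
    using assms by (simp add: kron_vec_def numeral_2_eq_2)
  also have "vec_of_list [1, x (Suc p)] $ (k mod 2) = (if even k then 1 else x (Suc p))"
    by (cases "even k") (simp_all add: even_iff_mod_2_eq_zero odd_iff_mod_2_eq_one vec_of_list_index
        del: vec_of_list_Cons)
  finally show ?thesis .
qed

declare tensor_vec.simps(2) [simp del]

text \<open>Common factors square to 1, so the product belongs to the symmetric difference of the
  two index sets, and \<open>m\<close> is the bitwise exclusive or of \<open>k\<close> and
  \<open>l\<close>. It is chosen before \<open>x\<close>, so one index serves all sample
  points.\<close>

lemma tensor_vec_mult_closed:
  assumes "k < 2 ^ p" "l < 2 ^ p"
  shows "\<exists>m<2 ^ p. \<forall>x :: nat \<Rightarrow> 'a::comm_ring_1. (\<forall>j\<in>{1..p}. x j * x j = 1) \<longrightarrow>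
    tensor_vec x p $ k * tensor_vec x p $ l = tensor_vec x p $ m"
  using assms
proof (induction p arbitrary: k l)
  case 0
  then show ?case by simp
next
  case (Suc p)
  have "k div 2 < 2 ^ p" "l div 2 < 2 ^ p" using Suc.prems by auto
  from Suc.IH[OF this] obtain m where m: "m < 2 ^ p"
    "\<And>x :: nat \<Rightarrow> 'a. (\<forall>j\<in>{1..p}. x j * x j = 1) \<Longrightarrow>
       tensor_vec x p $ (k div 2) * tensor_vec x p $ (l div 2) = tensor_vec x p $ m"
    by blast
  show ?case
  proof (intro exI conjI allI impI)
    \<comment> \<open>The witness appends to \<open>m\<close> the exclusive or of the lowest bits of
      \<open>k\<close> and \<open>l\<close>.\<close>
    show less: "2 * m + (k + l) mod 2 < 2 ^ Suc p" using m(1) by simp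
    fix x :: "nat \<Rightarrow> 'a"
    assume x: "\<forall>j\<in>{1..Suc p}. x j * x j = 1"
    have div: "(2 * m + (k + l) mod 2) div 2 = m" and par: "even (2 * m + (k + l) mod 2) = even (k + l)"
      by (auto simp: mod_2_eq_odd)
    have "tensor_vec x (Suc p) $ k * tensor_vec x (Suc p) $ l =
      (tensor_vec x p $ (k div 2) * tensor_vec x p $ (l div 2)) *
      ((if even k then 1 else x (Suc p)) * (if even l then 1 else x (Suc p)))"
      by (simp only: tensor_vec_Suc[OF Suc.prems(1)] tensor_vec_Suc[OF Suc.prems(2)] ac_simps)
    also have "\<dots> = tensor_vec x p $ m * (if even (k + l) then 1 else x (Suc p))"
      using m(2)[of x] x by auto
    also have "\<dots> = tensor_vec x (Suc p) $ (2 * m + (k + l) mod 2)"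
      unfolding tensor_vec_Suc[OF less] div par ..
    finally show "tensor_vec x (Suc p) $ k * tensor_vec x (Suc p) $ l =
      tensor_vec x (Suc p) $ (2 * m + (k + l) mod 2)" .
  qed
qed

lemma tensor_vec_one: "tensor_vec x p $ 0 = 1"
proof (induction p)
  case (Suc p)
  then show ?case using tensor_vec_Suc[of 0 p x] by simp
qed simp

text \<open>The index encodes the singleton of \<open>j\<close>: it is 1 when \<open>j\<close> is
  the newest variable and doubles with every later one. Again it is uniform in
  \<open>x\<close>.\<close>

lemma tensor_vec_generator:
  assumes "j \<in> {1..p}"
  shows "\<exists>k<2 ^ p. \<forall>x :: nat \<Rightarrow> 'a::comm_ring_1. tensor_vec x p $ k = x j"
  using assms
proof (induction p)
  case 0
  then show ?case by simp
next
  case (Suc p)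
  show ?case
  proof (cases "j = Suc p")
    case True
    have "tensor_vec x (Suc p) $ 1 = x j" for x :: "nat \<Rightarrow> 'a"
    proof -
      have "tensor_vec x (Suc p) $ 1 = tensor_vec x p $ (1 div 2) * (if even (1::nat) then 1 else x (Suc p))"
        by (rule tensor_vec_Suc) (metis one_less_numeral_iff one_less_power semiring_norm(76) zero_less_Suc)
      also have "1 div 2 = (0::nat)" by simp
      finally show ?thesis using True tensor_vec_one[of x p] by simp
    qed
    moreover have "(1::nat) < 2 ^ Suc p"
      by (metis one_less_numeral_iff one_less_power semiring_norm(76) zero_less_Suc)
    ultimately show ?thesis by blast
  next
    case False
    then obtain k where k: "k < 2 ^ p" "\<And>x :: nat \<Rightarrow> 'a. tensor_vec x p $ k = x j"
      using Suc by auto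
    have "tensor_vec x (Suc p) $ (2 * k) = x j" for x :: "nat \<Rightarrow> 'a"
      using k tensor_vec_Suc[of "2 * k" p x] by simp
    moreover have "2 * k < 2 ^ Suc p" using k(1) by simp
    ultimately show ?thesis by blast
  qed
qed

lemma tensor_vec_sign:
  assumes "k < 2 ^ p" "\<forall>j\<in>{1..p}. x j \<in> {-1, 1}"
  shows "tensor_vec x p $ k \<in> {-1, 1}"
  using assms
proof (induction p arbitrary: k)
  case (Suc p)
  then have "tensor_vec x p $ (k div 2) \<in> {-1, 1}" by auto
  moreover have "x (Suc p) \<in> {-1, 1}" using Suc.prems by auto
  ultimately show ?case unfolding tensor_vec_Suc[OF Suc.prems(1)] by auto
qed simp

lemma tensor_vec_measurable:
  fixes A :: "nat \<Rightarrow> 'a \<Rightarrow> real"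
  assumes "k < 2 ^ p" "\<forall>j\<in>{1..p}. A j \<in> borel_measurable N"
  shows "(\<lambda>\<omega>. tensor_vec (\<lambda>j. A j \<omega>) p $ k) \<in> borel_measurable N"
  using assms
proof (induction p arbitrary: k)
  case (Suc p)
  then have [measurable]: "(\<lambda>\<omega>. tensor_vec (\<lambda>j. A j \<omega>) p $ (k div 2)) \<in> borel_measurable N"
    by auto
  have [measurable]: "A (Suc p) \<in> borel_measurable N" using Suc.prems by auto
  show ?case unfolding tensor_vec_Suc[OF Suc.prems(1)] by measurable
qed simp

section \<open>The group as the set of tensor coordinates\<close>

text \<open>The restriction to \<open>space M\<close> makes this an element of
  \<open>sign_rv_group M\<close>, in exactly the form that \<open>coeff_of\<close> compares with
  \<Lambda>.\<close>

definition tensor_coord :: "'a measure \<Rightarrow> (nat \<Rightarrow> 'a \<Rightarrow> real) \<Rightarrow> nat \<Rightarrow> nat \<Rightarrow> 'a \<Rightarrow> real" where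
  "tensor_coord M A p k = (\<lambda>\<omega>\<in>space M. tensor_vec (\<lambda>j. A j \<omega>) p $ k)"

lemma sign_rv_group_carrierI:
  assumes "X \<in> borel_measurable M" "\<And>\<omega>. \<omega> \<in> space M \<Longrightarrow> X \<omega> \<in> {-1, 1}"
  shows "restrict X (space M) \<in> carrier (sign_rv_group M)"
proof -
  have "restrict X (space M) \<in> borel_measurable M"
    using assms(1) by (subst measurable_cong[where g = X]) auto
  with assms(2) show ?thesis by (simp only: sign_rv_group_def partial_object.simps mem_Collect_eq) auto
qed

lemma sign_rv_group_carrierD:
  assumes "X \<in> carrier (sign_rv_group M)" "\<omega> \<in> space M"
  shows "X \<omega> \<in> {-1, 1}"
  using assms unfolding sign_rv_group_def
  by (simp only: partial_object.simps PiE_iff mem_Collect_eq)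

lemma sign_rv_group_inv:
  assumes "X \<in> carrier (sign_rv_group M)"
  shows "inv\<^bsub>sign_rv_group M\<^esub> X = X"
proof -
  interpret comm_group "sign_rv_group M" by (rule comm_group_sign_rv_group)
  note sign = sign_rv_group_carrierD[OF assms]
  then have "X \<otimes>\<^bsub>sign_rv_group M\<^esub> X = \<one>\<^bsub>sign_rv_group M\<^esub>"
    by (force simp: sign_rv_group_def fun_eq_iff restrict_def)
  then show ?thesis by (intro inv_equality assms)
qed

lemma tensor_coord_carrier:
  assumes "\<forall>j\<in>{1..p}. A j \<in> borel_measurable M"
    and "\<forall>j\<in>{1..p}. \<forall>\<omega>\<in>space M. A j \<omega> \<in> {-1, 1}" and "k < 2 ^ p"
  shows "tensor_coord M A p k \<in> carrier (sign_rv_group M)"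
  unfolding tensor_coord_def
  by (intro sign_rv_group_carrierI tensor_vec_measurable tensor_vec_sign) (use assms in auto)

text \<open>The coordinates contain the unit and the generators and are closed under products, while
  inverses are trivial because signs square to 1. Conversely, each coordinate is built from
  generators one binary digit at a time.\<close>

lemma rv_group_eq:
  assumes A: "\<forall>j\<in>{1..p}. A j \<in> borel_measurable M"
    "\<forall>j\<in>{1..p}. \<forall>\<omega>\<in>space M. A j \<omega> \<in> {-1, 1}"
  shows "rv_group M A p = tensor_coord M A p ` {..<2 ^ p}"
proof
  interpret comm_group "sign_rv_group M" by (rule comm_group_sign_rv_group)
  have gen: "restrict (A j) (space M) \<in> tensor_coord M A p ` {..<2 ^ p}" if j: "j \<in> {1..p}" for j
  proof -
    obtain k where k: "k < 2 ^ p" "\<And>x :: nat \<Rightarrow> real. tensor_vec x p $ k = x j"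
      using tensor_vec_generator[OF j] by blast
    then have "restrict (A j) (space M) = tensor_coord M A p k" by (simp add: tensor_coord_def)
    with k(1) show ?thesis by blast
  qed
  show "rv_group M A p \<subseteq> tensor_coord M A p ` {..<2 ^ p}"
  proof
    fix X assume "X \<in> rv_group M A p"
    then show "X \<in> tensor_coord M A p ` {..<2 ^ p}"
      unfolding rv_group_def
    proof (induction rule: generate.induct)
      case one
      have "\<one>\<^bsub>sign_rv_group M\<^esub> = tensor_coord M A p 0"
        by (simp add: sign_rv_group_def tensor_coord_def tensor_vec_one)
      then show ?case by auto
    next
      case (incl h)
      then show ?case using gen by blast
    next
      case (inv h)
      then have "h \<in> tensor_coord M A p ` {..<2 ^ p}" using gen by auto
      then show ?case using tensor_coord_carrier[OF A] by (auto simp: sign_rv_group_inv)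
    next
      case (eng h1 h2)
      then obtain k l where kl: "k < 2 ^ p" "h1 = tensor_coord M A p k" "l < 2 ^ p"
        "h2 = tensor_coord M A p l" by auto
      obtain m where m: "m < 2 ^ p" "\<And>x :: nat \<Rightarrow> real. (\<forall>j\<in>{1..p}. x j * x j = 1) \<Longrightarrow>
          tensor_vec x p $ k * tensor_vec x p $ l = tensor_vec x p $ m"
        using tensor_vec_mult_closed[OF kl(1,3)] by blast
      have "h1 \<otimes>\<^bsub>sign_rv_group M\<^esub> h2 = tensor_coord M A p m"
      proof -
        have "tensor_vec (\<lambda>j. A j \<omega>) p $ k * tensor_vec (\<lambda>j. A j \<omega>) p $ l =
            tensor_vec (\<lambda>j. A j \<omega>) p $ m" if "\<omega> \<in> space M" for \<omega>
          by (rule m(2)) (use A(2) that in fastforce)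
        then show ?thesis
          by (simp add: sign_rv_group_def kl tensor_coord_def restrict_def fun_eq_iff)
      qed
      with m(1) show ?case by auto
    qed
  qed
  have "tensor_coord M A p k \<in> rv_group M A p" if "k < 2 ^ p" for k
    using that
  proof (induction p arbitrary: k)
    case 0
    then have "tensor_coord M A 0 k = \<one>\<^bsub>sign_rv_group M\<^esub>"
      by (simp add: sign_rv_group_def tensor_coord_def)
    then show ?case by (simp add: rv_group_def generate.one)
  next
    case (Suc p)
    have "tensor_coord M A p (k div 2) \<in> rv_group M A p" using Suc by auto
    also have "\<dots> \<subseteq> rv_group M A (Suc p)"
      unfolding rv_group_def by (intro mono_generate image_mono) auto
    finally have k: "tensor_coord M A p (k div 2) \<in> rv_group M A (Suc p)" .
    have s: "restrict (A (Suc p)) (space M) \<in> rv_group M A (Suc p)"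
      unfolding rv_group_def by (intro generate.incl) auto
    show ?case
    proof (cases "even k")
      case True
      then have "tensor_coord M A (Suc p) k = tensor_coord M A p (k div 2)"
        unfolding tensor_coord_def tensor_vec_Suc[OF Suc.prems] by simp
      with k show ?thesis by simp
    next
      case False
      then have "tensor_coord M A (Suc p) k =
          tensor_coord M A p (k div 2) \<otimes>\<^bsub>sign_rv_group M\<^esub> restrict (A (Suc p)) (space M)"
        unfolding tensor_coord_def tensor_vec_Suc[OF Suc.prems]
        by (simp add: sign_rv_group_def restrict_def fun_eq_iff)
      with k s show ?thesis unfolding rv_group_def by (simp add: generate.eng)
    qed
  qed
  then show "tensor_coord M A p ` {..<2 ^ p} \<subseteq> rv_group M A p" by auto
qed

section \<open>Consequences of positive definiteness\<close>

text \<open>Entry \<open>i\<close> of \<open>Q M p *\<^sub>v v\<close> is the expectation of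
  coordinate \<open>i\<close> times
  \<open>v \<bullet> tensor_vec (\<lambda>j. A j \<omega>) p\<close>. If the latter vanishes almost
  everywhere, the quadratic form vanishes at \<open>v\<close>.\<close>

lemma tensor_vec_linear_independent:
  fixes A :: "nat \<Rightarrow> 'a \<Rightarrow> real"
  defines "Q M p \<equiv> expectation_mat M (2 ^ p) (2 ^ p)
             (\<lambda>\<omega>. outer_prod (tensor_vec (\<lambda>j. A j \<omega>) p) (tensor_vec (\<lambda>j. A j \<omega>) p))"
  assumes M: "prob_space M" and A: "\<forall>j\<in>{1..p}. A j \<in> borel_measurable M"
    "\<forall>j\<in>{1..p}. \<forall>\<omega>\<in>space M. A j \<omega> \<in> {-1, 1}"
    and pd: "positive_definite (2 ^ p) (Q M p)"
    and v: "v \<in> carrier_vec (2 ^ p)" "AE \<omega> in M. v \<bullet> tensor_vec (\<lambda>j. A j \<omega>) p = 0"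
  shows "v = 0\<^sub>v (2 ^ p)"
proof (rule ccontr)
  interpret prob_space M by fact
  assume "v \<noteq> 0\<^sub>v (2 ^ p)"
  then have pos: "v \<bullet> (Q M p *\<^sub>v v) > 0" using pd v unfolding positive_definite_def by blast
  let ?t = "\<lambda>k \<omega>. tensor_vec (\<lambda>j. A j \<omega>) p $ k"
  have [measurable]: "?t k \<in> borel_measurable M" if "k < 2 ^ p" for k
    using tensor_vec_measurable[OF that A(1)] .
  have int: "integrable M (\<lambda>\<omega>. ?t i \<omega> * ?t j \<omega>)" if ij: "i < 2 ^ p" "j < 2 ^ p" for i j
  proof (rule integrable_const_bound[of _ 1])
    have "\<bar>?t k \<omega>\<bar> = 1" if "\<omega> \<in> space M" "k < 2 ^ p" for k \<omega>
      using tensor_vec_sign[of k p "\<lambda>j. A j \<omega>"] that A(2) by auto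
    with ij show "AE \<omega> in M. norm (?t i \<omega> * ?t j \<omega>) \<le> 1" by (auto simp: abs_mult)
  qed (use ij in measurable)
  have "(Q M p *\<^sub>v v) $ i = 0" if i: "i < 2 ^ p" for i
  proof -
    have "(Q M p *\<^sub>v v) $ i = (\<Sum>j\<in>{0..<2 ^ p}. (\<integral>\<omega>. ?t i \<omega> * ?t j \<omega> \<partial>M) * v $ j)"
      using i v(1) by (auto simp: Q_def expectation_mat_def outer_prod_def scalar_prod_def row_def
          intro!: sum.cong)
    also have "\<dots> = (\<integral>\<omega>. (\<Sum>j\<in>{0..<2 ^ p}. ?t i \<omega> * ?t j \<omega> * v $ j) \<partial>M)"
      by (subst Bochner_Integration.integral_sum) (use i int in auto)
    also have "\<dots> = (\<integral>\<omega>. ?t i \<omega> * (v \<bullet> tensor_vec (\<lambda>j. A j \<omega>) p) \<partial>M)"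
      by (simp add: scalar_prod_def sum_distrib_left ac_simps)
    also have "\<dots> = 0"
      by (rule integral_eq_zero_AE) (use v(2) in auto)
    finally show ?thesis .
  qed
  then have "v \<bullet> (Q M p *\<^sub>v v) = 0"
    by (simp add: scalar_prod_def Q_def expectation_mat_def)
  with pos show False by simp
qed

text \<open>Two equal coordinates would let the difference of two unit vectors annihilate the tensor
  vector. Injectivity gives the description in \<open>coeff_of\<close> a unique witness and allows
  sums over the group to be indexed by \<open>k\<close>.\<close>

lemma tensor_coord_inj:
  assumes M: "prob_space M" and A: "\<forall>j\<in>{1..p}. A j \<in> borel_measurable M"
    "\<forall>j\<in>{1..p}. \<forall>\<omega>\<in>space M. A j \<omega> \<in> {-1, 1}"
    and pd: "positive_definite (2 ^ p) (expectation_mat M (2 ^ p) (2 ^ p)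
             (\<lambda>\<omega>. outer_prod (tensor_vec (\<lambda>j. A j \<omega>) p) (tensor_vec (\<lambda>j. A j \<omega>) p)))"
  shows "inj_on (tensor_coord M A p) {..<2 ^ p}"
proof (rule inj_onI, rule ccontr)
  fix k l assume kl: "k \<in> {..<2 ^ p}" "l \<in> {..<2 ^ p}" and "k \<noteq> l"
    and eq: "tensor_coord M A p k = tensor_coord M A p l"
  define v :: "real Matrix.vec" where "v = unit_vec (2 ^ p) k - unit_vec (2 ^ p) l"
  have "v \<bullet> tensor_vec (\<lambda>j. A j \<omega>) p = 0" if "\<omega> \<in> space M" for \<omega>
  proof -
    have t: "tensor_vec (\<lambda>j. A j \<omega>) p \<in> carrier_vec (2 ^ p)" by (rule carrier_vecI) simp
    have "v \<bullet> tensor_vec (\<lambda>j. A j \<omega>) p =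
        tensor_vec (\<lambda>j. A j \<omega>) p $ k - tensor_vec (\<lambda>j. A j \<omega>) p $ l"
      unfolding v_def using kl t by (subst minus_scalar_prod_distrib[OF _ _ t]) auto
    also have "\<dots> = tensor_coord M A p k \<omega> - tensor_coord M A p l \<omega>"
      using that by (simp add: tensor_coord_def)
    finally show ?thesis using eq by simp
  qed
  then have "v = 0\<^sub>v (2 ^ p)"
    by (intro tensor_vec_linear_independent[OF M A pd]) (auto simp: v_def)
  then have "v $ k = 0" using kl by simp
  then show False using kl \<open>k \<noteq> l\<close> by (simp add: v_def)
qed

lemma measurable_restrict_space_iff:
  assumes "space N = space M"
  shows "restrict f (space M) \<in> borel_measurable N \<longleftrightarrow> f \<in> borel_measurable N"
  by (rule measurable_cong) (simp add: assms)

lemma tensor_coord_measurable: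
  fixes A :: "nat \<Rightarrow> 'a \<Rightarrow> real"
  assumes "k < 2 ^ p" "\<forall>j\<in>{1..p}. A j \<in> borel_measurable N" "space N = space M"
  shows "tensor_coord M A p k \<in> borel_measurable N"
  unfolding tensor_coord_def measurable_restrict_space_iff[OF assms(3)]
  using assms(1,2) by (rule tensor_vec_measurable)

text \<open>This links conditioning on the variables \<open>A j\<close>, as in the hypothesis on
  \<beta>, with conditional independence from the whole group.\<close>

lemma sets_rv_sigma_rv_group:
  assumes A: "\<forall>j\<in>{1..p}. A j \<in> borel_measurable M"
    "\<forall>j\<in>{1..p}. \<forall>\<omega>\<in>space M. A j \<omega> \<in> {-1, 1}"
  shows "sets (rv_sigma M (rv_group M A p)) = sets (rv_sigma M (A ` {1..p}))"
proof (intro equalityI sets_rv_sigma_subset)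
  fix X assume "X \<in> rv_group M A p"
  then show "X \<in> borel_measurable (rv_sigma M (A ` {1..p}))"
    unfolding rv_group_eq[OF A]
    by (auto intro!: tensor_coord_measurable intro: measurable_rv_sigma[OF imageI])
next
  fix X assume "X \<in> A ` {1..p}"
  then have "restrict X (space M) \<in> rv_group M A p"
    unfolding rv_group_def by (auto intro: generate.incl)
  from measurable_rv_sigma[OF this, of M] show "X \<in> borel_measurable (rv_sigma M (rv_group M A p))"
    unfolding measurable_restrict_space_iff[OF space_rv_sigma] .
qed simp_all

section \<open>Linear expansion over a generated group\<close>

text \<open>Linear combinations of the generated group contain the constants, as multiples of the
  unit, and are closed under sums. Multiplication by a member of \<open>S\<close> permutes the group
  and hence only permutes coefficients, so \<open>saturated_induct\<close> applies.\<close>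

lemma generate_linear_combination:
  fixes f :: "'a \<Rightarrow> real"
  assumes S: "S \<subseteq> carrier (sign_rv_group M)" and fin: "finite (generate (sign_rv_group M) S)"
    and f: "f \<in> borel_measurable (rv_sigma M S)"
  shows "\<exists>c. \<forall>\<omega>\<in>space M. f \<omega> = (\<Sum>X\<in>generate (sign_rv_group M) S. c X * X \<omega>)"
proof -
  interpret comm_group "sign_rv_group M" by (rule comm_group_sign_rv_group)
  define K where "K = generate (sign_rv_group M) S"
  have SK: "S \<subseteq> K" by (auto simp: K_def intro: generate.incl)
  have finK: "finite K" using fin by (simp add: K_def)
  define P where "P f \<longleftrightarrow> (\<exists>c. \<forall>\<omega>\<in>space M. f \<omega> = (\<Sum>X\<in>K. c X * X \<omega>))" for f :: "'a \<Rightarrow> real"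
  have "P f"
  proof (rule saturated_induct[where S = S and \<Omega> = "space M"])
    show "finite S" using SK finK by (rule finite_subset)
    show "X \<omega> \<in> {-1, 1}" if "X \<in> S" "\<omega> \<in> space M" for X \<omega>
      using sign_rv_group_carrierD[OF subsetD[OF S]] that .
    show "P f" if "\<And>\<omega>. \<omega> \<in> space M \<Longrightarrow> f \<omega> = g \<omega>" "P g" for f g
      using that by (simp add: P_def)
    show "P (\<lambda>\<omega>. c)" for c
    proof -
      let ?one = "\<one>\<^bsub>sign_rv_group M\<^esub>"
      have "c = (\<Sum>X\<in>K. (if X = ?one then c else 0) * X \<omega>)" if "\<omega> \<in> space M" for \<omega>
      proof -
        have "(\<Sum>X\<in>K. (if X = ?one then c else 0) * X \<omega>) = (\<Sum>X\<in>K. if X = ?one then c * ?one \<omega> else 0)"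
          by (rule sum.cong) auto
        also have "\<dots> = c * ?one \<omega>"
          using finK by (simp add: K_def generate.one)
        also have "\<dots> = c" using that by (simp add: sign_rv_group_def)
        finally show ?thesis ..
      qed
      then show ?thesis unfolding P_def by (intro exI ballI)
    qed
    show "P (\<lambda>\<omega>. f \<omega> + g \<omega>)" if "P f" "P g" for f g
    proof -
      from that obtain c d where "\<forall>\<omega>\<in>space M. f \<omega> = (\<Sum>X\<in>K. c X * X \<omega>)"
        "\<forall>\<omega>\<in>space M. g \<omega> = (\<Sum>X\<in>K. d X * X \<omega>)" unfolding P_def by blast
      then have "\<And>\<omega>. \<omega> \<in> space M \<Longrightarrow> f \<omega> + g \<omega> = (\<Sum>X\<in>K. (c X + d X) * X \<omega>)"
        by (simp add: sum.distrib distrib_right)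
      then show ?thesis unfolding P_def by (intro exI ballI)
    qed
    show "P (\<lambda>\<omega>. Y \<omega> * f \<omega>)" if Y: "Y \<in> S" and f: "P f" for Y f
    proof -
      let ?m = "\<lambda>X. Y \<otimes>\<^bsub>sign_rv_group M\<^esub> X"
      have mK: "?m X \<in> K" if "X \<in> K" for X
        using that Y unfolding K_def by (blast intro: generate.intros)
      have mm: "?m (?m X) = X" if "X \<in> K" for X
      proof -
        have "Y \<in> carrier (sign_rv_group M)" "X \<in> carrier (sign_rv_group M)"
          using Y S that generate_in_carrier[OF S] unfolding K_def by auto
        then show ?thesis
          using l_inv[of Y] by (simp add: sign_rv_group_inv flip: m_assoc)
      qed
      from f obtain c where c: "\<And>\<omega>. \<omega> \<in> space M \<Longrightarrow> f \<omega> = (\<Sum>X\<in>K. c X * X \<omega>)"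
        unfolding P_def by blast
      have "Y \<omega> * f \<omega> = (\<Sum>X\<in>K. c (?m X) * X \<omega>)" if \<omega>: "\<omega> \<in> space M" for \<omega>
      proof -
        have "Y \<omega> * f \<omega> = (\<Sum>X\<in>K. c X * ?m X \<omega>)"
          using \<omega> by (simp add: c sum_distrib_left sign_rv_group_def ac_simps)
        \<comment> \<open>Multiplication by \<open>Y\<close> is an involution of \<open>K\<close>,
          so it serves as its own inverse in the reindexing.\<close>
        also have "\<dots> = (\<Sum>X\<in>K. c (?m X) * X \<omega>)"
          by (rule sum.reindex_bij_witness[of _ ?m ?m]) (simp_all add: mK mm)
        finally show ?thesis .
      qed
      then show ?thesis unfolding P_def by (intro exI ballI)
    qed
    show "f \<omega> = f \<omega>'" if "\<omega> \<in> space M" "\<omega>' \<in> space M" "\<And>X. X \<in> S \<Longrightarrow> X \<omega> = X \<omega>'" for \<omega> \<omega>'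
      using borel_measurable_rv_sigma_saturated[OF f that] .
  qed
  then show ?thesis by (simp add: P_def K_def)
qed

section \<open>Coefficients and conditional independence\<close>

theorem theorem2p5:
  fixes M :: "'a measure"
    and B :: "'a \<Rightarrow> real"
    and A :: "nat \<Rightarrow> 'a \<Rightarrow> real"
    and p :: nat
    and \<beta> :: "real Matrix.vec"
  assumes "prob_space M"
    and "B \<in> borel_measurable M"
    and "\<forall>\<omega>\<in>space M. B \<omega> \<in> {-1, 1}"
    and "\<forall>j\<in>{1..p}. A j \<in> borel_measurable M"
    and "\<forall>j\<in>{1..p}. \<forall>\<omega>\<in>space M. A j \<omega> \<in> {-1, 1}"
    and "positive_definite (2 ^ p)
           (expectation_mat M (2 ^ p) (2 ^ p)
             (\<lambda>\<omega>. outer_prod (tensor_vec (\<lambda>j. A j \<omega>) p) (tensor_vec (\<lambda>j. A j \<omega>) p)))"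
    and "\<beta> \<in> carrier_vec (2 ^ p)"
    and "AE \<omega> in M. real_cond_exp M (rv_sigma M (A ` {1..p})) B \<omega> =
           \<beta> \<bullet> tensor_vec (\<lambda>j. A j \<omega>) p"
  shows "cond_indep_rvs M {B} (rv_group M A p)
           (generate (sign_rv_group M) {\<Lambda> \<in> rv_group M A p. coeff_of M A p \<beta> \<Lambda> \<noteq> 0})
       \<and> (\<forall>S. S \<subseteq> rv_group M A p \<longrightarrow>
             cond_indep_rvs M {B} (rv_group M A p) S \<longrightarrow>
             (\<forall>\<Lambda> \<in> rv_group M A p - generate (sign_rv_group M) S. coeff_of M A p \<beta> \<Lambda> = 0))"
proof -
  note M = assms(1) and A = assms(4,5) and pd = assms(6) and \<beta> = assms(7,8)
  interpret prob_space M by fact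
  interpret group: comm_group "sign_rv_group M" by (rule comm_group_sign_rv_group)
  let ?F = "rv_sigma M (A ` {1..p})"
  let ?G = "rv_group M A p"
  let ?T = "tensor_coord M A p"
  note G_eq = rv_group_eq[OF A]
  note inj = tensor_coord_inj[OF M A pd]
  have G_carrier: "?G \<subseteq> carrier (sign_rv_group M)"
    unfolding G_eq using tensor_coord_carrier[OF A] by auto
  have "subgroup ?G (sign_rv_group M)"
    unfolding rv_group_def
    by (rule group.generate_is_subgroup) (use A in \<open>blast intro: sign_rv_group_carrierI\<close>)
  then have gen_G: "generate (sign_rv_group M) S \<subseteq> ?G" if "S \<subseteq> ?G" for S
    using that group.generate_subgroup_incl by blast
  have F: "subalgebra M ?F"
    unfolding subalgebra_def by (intro conjI sets_rv_sigma_subset) (use A in auto)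
  have H: "subalgebra ?F (rv_sigma M S)" if "S \<subseteq> ?G" for S
  proof -
    have "sets (rv_sigma M S) \<subseteq> sets (rv_sigma M ?G)"
      using that by (intro sets_rv_sigma_subset) (auto intro: measurable_rv_sigma)
    then show ?thesis by (simp add: subalgebra_def sets_rv_sigma_rv_group[OF A])
  qed
  \<comment> \<open>The sigma-field of the group enters the definition only through its events, so
    it may be replaced by \<open>?F\<close>.\<close>
  have indep_iff: "cond_indep_rvs M {B} ?G S \<longleftrightarrow>
      (AE \<omega> in M. real_cond_exp M ?F B \<omega> = real_cond_exp M (rv_sigma M S) B \<omega>)"
    if "S \<subseteq> ?G" for S
    using cond_indep_sigma_sign_iff[OF M F H[OF that] assms(2)] assms(3)
    by (simp add: cond_indep_rvs_def cond_indep_sigma_def sets_rv_sigma_rv_group[OF A])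
  have coeff: "coeff_of M A p \<beta> (?T k) = \<beta> $ k" if "k < 2 ^ p" for k
  proof -
    have "(THE l. l < 2 ^ p \<and> ?T l = ?T k) = k"
      using that inj by (intro the_equality) (auto dest: inj_onD)
    then show ?thesis by (simp add: coeff_of_def tensor_coord_def)
  qed
  have prod: "v \<bullet> tensor_vec (\<lambda>j. A j \<omega>) p = (\<Sum>k<2 ^ p. v $ k * ?T k \<omega>)"
    if "\<omega> \<in> space M" for v \<omega>
    using that by (simp add: scalar_prod_def tensor_coord_def atLeast0LessThan)
  have intB: "integrable M B"
    by (rule integrable_const_bound[of _ 1]) (use assms(2,3) in \<open>force intro!: AE_I2\<close>)+
  show ?thesis
  proof (intro conjI allI impI)
    define L where "L = {\<Lambda> \<in> ?G. coeff_of M A p \<beta> \<Lambda> \<noteq> 0}"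
    define K where "K = generate (sign_rv_group M) L"
    let ?H = "rv_sigma M K"
    let ?g = "\<lambda>\<omega>. \<Sum>k<2 ^ p. \<beta> $ k * ?T k \<omega>"
    have K: "K \<subseteq> ?G" unfolding K_def by (rule gen_G) (auto simp: L_def)
    have MH: "subalgebra M ?H"
      using F H[OF K] by (auto simp: subalgebra_def)
    interpret H: finite_measure_subalgebra M ?H by unfold_locales fact
    \<comment> \<open>Terms with zero coefficient vanish; in all others the coordinate lies in
      \<open>L\<close>, hence in \<open>K\<close>.\<close>
    have "(\<lambda>\<omega>. \<beta> $ k * ?T k \<omega>) \<in> borel_measurable ?H" if "k < 2 ^ p" for k
    proof (cases "\<beta> $ k = 0")
      case False
      then have "?T k \<in> K"
        using that by (auto simp: K_def L_def coeff G_eq intro!: generate.incl)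
      then have [measurable]: "?T k \<in> borel_measurable ?H" by (rule measurable_rv_sigma)
      show ?thesis by measurable
    qed simp
    then have g: "?g \<in> borel_measurable ?H" by (intro borel_measurable_sum) auto
    have 1: "AE \<omega> in M. real_cond_exp M ?F B \<omega> = ?g \<omega>"
      using \<beta>(2) AE_space by eventually_elim (simp add: prod)
    have gM: "?g \<in> borel_measurable M" using measurable_from_subalg[OF MH g] .
    interpret F: finite_measure_subalgebra M ?F by unfold_locales fact
    have intg: "integrable M ?g"
      using F.real_cond_exp_int(1)[OF intB] 1 gM
      by (subst integrable_cong_AE[where g = "real_cond_exp M ?F B"]) (auto elim: AE_mp)
    \<comment> \<open>Conditioning \<open>?g\<close>, a version of the expectation of
      \<open>B\<close> given \<open>?F\<close>, on \<open>?H\<close> leaves it unchanged. By the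
      tower property it is therefore also a version given \<open>?H\<close>.\<close>
    have 2: "AE \<omega> in M. real_cond_exp M ?H (real_cond_exp M ?F B) \<omega> = real_cond_exp M ?H ?g \<omega>"
      by (rule H.real_cond_exp_cong[OF 1]) (use gM in auto)
    have 3: "AE \<omega> in M. real_cond_exp M ?H (real_cond_exp M ?F B) \<omega> = real_cond_exp M ?H B \<omega>"
      by (rule H.real_cond_exp_nested_subalg[OF F H[OF K] intB])
    have 4: "AE \<omega> in M. real_cond_exp M ?H ?g \<omega> = ?g \<omega>"
      by (rule H.real_cond_exp_F_meas[OF intg g])
    have "AE \<omega> in M. real_cond_exp M ?F B \<omega> = real_cond_exp M ?H B \<omega>"
      using 1 2 3 4 by eventually_elim simp
    then show "cond_indep_rvs M {B} ?G
        (generate (sign_rv_group M) {\<Lambda> \<in> ?G. coeff_of M A p \<beta> \<Lambda> \<noteq> 0})"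
      using indep_iff[OF K] by (simp add: K_def L_def)
  next
    fix S assume S: "S \<subseteq> ?G" and indep: "cond_indep_rvs M {B} ?G S"
    define K where "K = generate (sign_rv_group M) S"
    have K: "K \<subseteq> ?G" unfolding K_def by (rule gen_G[OF S])
    have "finite ?G" by (simp add: G_eq)
    with K have finK: "finite K" by (rule finite_subset)
    \<comment> \<open>The version given by \<open>real_cond_exp\<close> is itself measurable for
      \<open>S\<close>, so the expansion holds at every point of \<open>space M\<close>.\<close>
    have "\<exists>c. \<forall>\<omega>\<in>space M. real_cond_exp M (rv_sigma M S) B \<omega> = (\<Sum>X\<in>K. c X * X \<omega>)"
      unfolding K_def
      by (rule generate_linear_combination)
        (use S G_carrier finK in \<open>auto simp: K_def borel_measurable_cond_exp\<close>)
    then obtain c where c: "\<And>\<omega>. \<omega> \<in> space M \<Longrightarrow>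
        real_cond_exp M (rv_sigma M S) B \<omega> = (\<Sum>X\<in>K. c X * X \<omega>)" by blast
    \<comment> \<open>The coefficients are extended by zero from \<open>K\<close> to all
      coordinates; hence \<open>v\<close>, defined below, agrees with \<beta> at every index whose
      coordinate lies outside \<open>K\<close>.\<close>
    define d where "d k = (if ?T k \<in> K then c (?T k) else 0)" for k
    have d: "(\<Sum>X\<in>K. c X * X \<omega>) = (\<Sum>k<2 ^ p. d k * ?T k \<omega>)" for \<omega>
    proof -
      have "(\<Sum>X\<in>K. c X * X \<omega>) = (\<Sum>X\<in>?G. (if X \<in> K then c X else 0) * X \<omega>)"
        using K \<open>finite ?G\<close> by (intro sum.mono_neutral_cong_left) auto
      also have "\<dots> = (\<Sum>k<2 ^ p. d k * ?T k \<omega>)"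
        unfolding G_eq by (simp add: sum.reindex[OF inj] d_def)
      finally show ?thesis .
    qed
    define v where "v = \<beta> - Matrix.vec (2 ^ p) d"
    have "AE \<omega> in M. v \<bullet> tensor_vec (\<lambda>j. A j \<omega>) p = 0"
      using indep[unfolded indep_iff[OF S]] \<beta>(2) AE_space
    proof eventually_elim
      case (elim \<omega>)
      have "v \<bullet> tensor_vec (\<lambda>j. A j \<omega>) p =
          (\<Sum>k<2 ^ p. \<beta> $ k * ?T k \<omega>) - (\<Sum>k<2 ^ p. d k * ?T k \<omega>)"
        using \<beta>(1) by (simp add: prod[OF elim(3)] v_def left_diff_distrib sum_subtractf)
      then show ?case
        using elim c[OF elim(3)] d[of \<omega>] by (simp add: prod[OF elim(3)])
    qed
    then have v: "v = 0\<^sub>v (2 ^ p)"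
      by (intro tensor_vec_linear_independent[OF M A pd]) (use \<beta>(1) in \<open>auto simp: v_def\<close>)
    show "\<forall>\<Lambda> \<in> ?G - generate (sign_rv_group M) S. coeff_of M A p \<beta> \<Lambda> = 0"
    proof
      fix \<Lambda> assume "\<Lambda> \<in> ?G - generate (sign_rv_group M) S"
      then obtain k where k: "k < 2 ^ p" "\<Lambda> = ?T k" "?T k \<notin> K" by (auto simp: G_eq K_def)
      have "v $ k = \<beta> $ k" using k \<beta>(1) by (simp add: v_def d_def)
      with v k(1) have "\<beta> $ k = 0" by simp
      with k show "coeff_of M A p \<beta> \<Lambda> = 0" by (simp add: coeff)
    qed
  qed
qed

end
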